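(* Let the growth condition (defined in the context) hold for the family $\mathcal S_{0,\infty}$. The following statements are equivalent: (i) the impulsive system is strongly UGES over $\mathcal S_{0,\infty}$; (ii) there exist constants $c>0$, $p\ge1$ and a time-independent functional $V:X\to\mathbb R_{\ge0}$, Lipschitz on bounded subsets of $X$, such that for all $x\in X$ $$V(x)\le c\|x\|^p,\qquad \underline D^+V(x)\le-\|x\|^p,\qquad V(Jx)-V(x)\le-\|x\|^p.$$ Moreover, when (i) holds, an explicit time-independent functional witnessing (ii) is $$V(x):=\sup_{\sigma\in\mathcal S_{0,\infty}}\left[\int_0^\infty\|U_\sigma(t,0)x\|^p\,dt+\sum_{k\ge1}\|U_\sigma(t_k^-,0)x\|^p\right].$$
   Context: Setting. $X$ is a Banach space with norm $\|\cdot\|$; $A:D(A)\subset X\to X$ generates a strongly continuous ($C_0$) semigroup $(S(t))_{t\ge0}$ on $X$; $J\in L(X)$ is bounded, $J\neq0$, $JD(A)\subset D(A)$. $\mathcal S_{0,\infty}$ is the set of sequences $\sigma=\{t_k\}_{k\ge1}$ with, setting $t_0:=0$, $t_{k+1}>t_k$ for all $k\ge0$ and $t_k\to\infty$; $\mathbb T_\sigma:=\{t_k:k\ge1\}$. The impulsive system is $\dot x(t)=Ax(t)$ for $t\notin\mathbb T_\sigma$, $x(t)=Jx(t^-)$ for $t\in\mathbb T_\sigma$. Its propagator $U_\sigma(t,s)$, $t\ge s\ge0$, is: $U_\sigma(t,s)=S(t-s)$ if $(s,t]\cap\mathbb T_\sigma=\varnothing$; otherwise, if $t_l<\dots<t_m$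 are the impulse times in $(s,t]$, $U_\sigma(t,s)=S(t-t_m)JS(t_m-t_{m-1})J\cdots JS(t_l-s)$. For $s<t_k$, $U_\sigma(t_k^-,s)x:=\lim_{t\uparrow t_k}U_\sigma(t,s)x$. $\kappa_\sigma(t,s):=\#(\mathbb T_\sigma\cap(s,t])$. Strong UGES over a family $\mathcal S\subset\mathcal S_{0,\infty}$: there exist $M\ge1$, $\alpha>0$, $\rho\in(0,1)$ such that $\|U_\sigma(t,s)\|\le M\rho^{\kappa_\sigma(t,s)}e^{-\alpha(t-s)}$ for all $t\ge s\ge0$ and all $\sigma\in\mathcal S$. Growth condition for $\mathcal S_{0,\infty}$: there exist a piecewise continuous $g:\mathbb R_{\ge0}\to\mathbb R_{>0}$ bounded below by some $c_0>0$, and $\mu>1$, such that $\|U_\sigma(t,s)x\|\le g(t-s)\mu^{\kappa_\sigma(t,s)}\|x\|$ for all $t\ge s\ge0$, $x\in X$, $\sigma\in\mathcal S_{0,\infty}$, and $G:=\sup_{\tau\ge0}g(\tau)<\infty$. $V:X\to\mathbb R_{\ge0}$ is Lipschitz on bounded subsets if for every $r>0$ there is $L_r>0$ with $|V(x)-V(y)|\le L_r\|x-y\|$ whenever $\|x\|<r$, $\|y\|<r$. $\underline D^+V(x):=\liminf_{h\downarrow0}h^{-1}\big(V(S(h)x)-V(x)\big)$. *)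

theory Defs
  imports "HOL-Analysis.Analysis"
begin

text \<open>Only the values \<open>S t\<close> with \<open>t \<ge> 0\<close> are meaningful.\<close>

definition C0_semigroup :: "(real \<Rightarrow> 'a::banach \<Rightarrow>\<^sub>L 'a) \<Rightarrow> bool" where
  "C0_semigroup S \<longleftrightarrow>
     S 0 = id_blinfun \<and>
     (\<forall>s\<ge>0. \<forall>t\<ge>0. S (s + t) = S s o\<^sub>L S t) \<and>
     (\<forall>x. ((\<lambda>t. S t x) \<longlongrightarrow> x) (at_right 0))"

definition generates :: "'a::banach set \<Rightarrow> ('a \<Rightarrow> 'a) \<Rightarrow> (real \<Rightarrow> 'a \<Rightarrow>\<^sub>L 'a) \<Rightarrow> bool" where
  "generates DA A S \<longleftrightarrow>
     C0_semigroup S \<and>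
     DA = {x. \<exists>y. ((\<lambda>h. (S h x - x) /\<^sub>R h) \<longlongrightarrow> y) (at_right 0)} \<and>
     (\<forall>x\<in>DA. ((\<lambda>h. (S h x - x) /\<^sub>R h) \<longlongrightarrow> A x) (at_right 0))"

text \<open>A sequence \<open>(t\<^sub>k)\<close>, \<open>k \<ge> 1\<close>, of impulse times is represented by \<open>\<sigma> :: nat \<Rightarrow> real\<close> with
  \<open>\<sigma> k = t\<^sub>k\<close>; the convention \<open>t\<^sub>0 = 0\<close> is built in as \<open>\<sigma> 0 = 0\<close>, but \<open>t\<^sub>0\<close> is not an impulse time.\<close>

definition impulse_seqs :: "(nat \<Rightarrow> real) set" where
  "impulse_seqs = {\<sigma>. \<sigma> 0 = 0 \<and> (\<forall>k. \<sigma> k < \<sigma> (Suc k)) \<and> filterlim \<sigma> at_top sequentially}"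

definition impulse_times :: "(nat \<Rightarrow> real) \<Rightarrow> real set" where
  "impulse_times \<sigma> = {\<sigma> k |k. 1 \<le> k}"

definition impulse_count :: "(nat \<Rightarrow> real) \<Rightarrow> real \<Rightarrow> real \<Rightarrow> nat" where
  "impulse_count \<sigma> t s = card (impulse_times \<sigma> \<inter> {s<..t})"

text \<open>\<open>evolve S J t s [\<tau>\<^sub>1, \<dots>, \<tau>\<^sub>n] = S (t - \<tau>\<^sub>n) J S (\<tau>\<^sub>n - \<tau>\<^sub>n\<^sub>-\<^sub>1) J \<dots> J S (\<tau>\<^sub>1 - s)\<close>\<close>

fun evolve :: "(real \<Rightarrow> 'a::banach \<Rightarrow>\<^sub>L 'a) \<Rightarrow> ('a \<Rightarrow>\<^sub>L 'a) \<Rightarrow> real \<Rightarrow> real \<Rightarrow> real list \<Rightarrow> 'a \<Rightarrow>\<^sub>L 'a" where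
  "evolve S J t s [] = S (t - s)"
| "evolve S J t s (\<tau> # \<tau>s) = evolve S J t \<tau> \<tau>s o\<^sub>L J o\<^sub>L S (\<tau> - s)"

text \<open>The propagator \<open>U\<^sub>\<sigma>(t, s)\<close>, meaningful for \<open>t \<ge> s \<ge> 0\<close>; the impulse times in \<open>(s, t]\<close> are
  finitely many for \<open>\<sigma> \<in> impulse_seqs\<close>.\<close>

definition propagator ::
    "(real \<Rightarrow> 'a::banach \<Rightarrow>\<^sub>L 'a) \<Rightarrow> ('a \<Rightarrow>\<^sub>L 'a) \<Rightarrow> (nat \<Rightarrow> real) \<Rightarrow> real \<Rightarrow> real \<Rightarrow> 'a \<Rightarrow>\<^sub>L 'a" where
  "propagator S J \<sigma> t s = evolve S J t s (sorted_list_of_set (impulse_times \<sigma> \<inter> {s<..t}))"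

definition propagator_left ::
    "(real \<Rightarrow> 'a::banach \<Rightarrow>\<^sub>L 'a) \<Rightarrow> ('a \<Rightarrow>\<^sub>L 'a) \<Rightarrow> (nat \<Rightarrow> real) \<Rightarrow> real \<Rightarrow> real \<Rightarrow> 'a \<Rightarrow> 'a" where
  "propagator_left S J \<sigma> t s x = Lim (at_left t) (\<lambda>r. propagator S J \<sigma> r s x)"

definition strong_UGES ::
    "(real \<Rightarrow> 'a::banach \<Rightarrow>\<^sub>L 'a) \<Rightarrow> ('a \<Rightarrow>\<^sub>L 'a) \<Rightarrow> (nat \<Rightarrow> real) set \<Rightarrow> bool" where
  "strong_UGES S J F \<longleftrightarrow>
     (\<exists>M \<alpha> \<rho>. M \<ge> 1 \<and> \<alpha> > 0 \<and> 0 < \<rho> \<and> \<rho> < 1 \<and>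
        (\<forall>\<sigma>\<in>F. \<forall>t s. 0 \<le> s \<and> s \<le> t \<longrightarrow>
           norm (propagator S J \<sigma> t s) \<le> M * \<rho> ^ impulse_count \<sigma> t s * exp (- \<alpha> * (t - s))))"

text \<open>Piecewise continuity on \<open>[0, \<infinity>)\<close>: on each bounded interval all but finitely many points are
  points of continuity, and the one-sided limits exist (in \<open>\<real>\<close>) at the exceptional ones.\<close>

definition piecewise_continuous_nonneg :: "(real \<Rightarrow> real) \<Rightarrow> bool" where
  "piecewise_continuous_nonneg g \<longleftrightarrow>
     (\<forall>T\<ge>0. \<exists>E. finite E \<and> E \<subseteq> {0..T} \<and>
        (\<forall>t\<in>{0..T} - E. continuous (at t within {0..}) g) \<and>
        (\<forall>t\<in>E. (\<exists>l. (g \<longlongrightarrow> l) (at_right t)) \<and> (t > 0 \<longrightarrow> (\<exists>l. (g \<longlongrightarrow> l) (at_left t)))))"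

definition growth_condition ::
    "(real \<Rightarrow> 'a::banach \<Rightarrow>\<^sub>L 'a) \<Rightarrow> ('a \<Rightarrow>\<^sub>L 'a) \<Rightarrow> (nat \<Rightarrow> real) set \<Rightarrow> bool" where
  "growth_condition S J F \<longleftrightarrow>
     (\<exists>g c0 \<mu>. piecewise_continuous_nonneg g \<and> c0 > 0 \<and> (\<forall>\<tau>\<ge>0. c0 \<le> g \<tau>) \<and>
        bdd_above (g ` {0..}) \<and> \<mu> > 1 \<and>
        (\<forall>\<sigma>\<in>F. \<forall>t s x. 0 \<le> s \<and> s \<le> t \<longrightarrow>
           norm (propagator S J \<sigma> t s x) \<le> g (t - s) * \<mu> ^ impulse_count \<sigma> t s * norm x))"

definition lipschitz_on_bounded :: "('a::banach \<Rightarrow> real) \<Rightarrow> bool" where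
  "lipschitz_on_bounded V \<longleftrightarrow>
     (\<forall>r>0. \<exists>L>0. \<forall>x y. norm x < r \<and> norm y < r \<longrightarrow> \<bar>V x - V y\<bar> \<le> L * norm (x - y))"

definition lower_right_Dini :: "(real \<Rightarrow> 'a::banach \<Rightarrow>\<^sub>L 'a) \<Rightarrow> ('a \<Rightarrow> real) \<Rightarrow> 'a \<Rightarrow> ereal" where
  "lower_right_Dini S V x = Liminf (at_right 0) (\<lambda>h. ereal ((V (S h x) - V x) / h))"

definition lyapunov_functional ::
    "(real \<Rightarrow> 'a::banach \<Rightarrow>\<^sub>L 'a) \<Rightarrow> ('a \<Rightarrow>\<^sub>L 'a) \<Rightarrow> real \<Rightarrow> real \<Rightarrow> ('a \<Rightarrow> real) \<Rightarrow> bool" where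
  "lyapunov_functional S J c p V \<longleftrightarrow>
     (\<forall>x. 0 \<le> V x) \<and> lipschitz_on_bounded V \<and>
     (\<forall>x. V x \<le> c * norm x powr p \<and>
          lower_right_Dini S V x \<le> ereal (- (norm x powr p)) \<and>
          V (J x) - V x \<le> - (norm x powr p))"

text \<open>The explicit functional is defined with values in \<open>[0, \<infinity>]\<close>, so that neither the integral, the
  series nor the supremum takes a junk value when it diverges.\<close>

definition explicit_V ::
    "(real \<Rightarrow> 'a::banach \<Rightarrow>\<^sub>L 'a) \<Rightarrow> ('a \<Rightarrow>\<^sub>L 'a) \<Rightarrow> real \<Rightarrow> 'a \<Rightarrow> ennreal" where
  "explicit_V S J p x =
     (SUP \<sigma>\<in>impulse_seqs.
        (\<integral>\<^sup>+t\<in>{0..}. ennreal (norm (propagator S J \<sigma> t 0 x) powr p) \<partial>lborel) +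
        (\<Sum>k. ennreal (norm (propagator_left S J \<sigma> (\<sigma> (Suc k)) 0 x) powr p)))"

end

theory Submission
  imports Defs
begin

text \<open>
  From a functional to stability. The jump inequality together with \<open>V (J x) \<ge> 0\<close> forces
  \<open>V x \<ge> \<parallel>x\<parallel>\<^sup>p\<close>, so \<open>V\<close> is automatically comparable to \<open>\<parallel>x\<parallel>\<^sup>p\<close> from both sides
  (\<open>lyapunov_coercive\<close>). Because \<open>\<parallel>x\<parallel>\<^sup>p \<ge> V x / c\<close>, the Dini inequality turns into exponential decay
  of \<open>V\<close> along the flow (\<open>exponential_decay_of_Dini\<close>, \<open>lyapunov_flow_decay\<close>), and the jump
  inequality makes every impulse multiply \<open>V\<close> by at most \<open>1 - 1/c\<close>
  (\<open>lyapunov_jump_decay\<close>). Multiplying these factors along the list of impulse times and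
  extracting a \<open>p\<close>-th root yields the estimate for the propagator.

  From stability to a functional. The explicit \<open>V\<close> is a worst-case cost over all impulse
  sequences. Admissible sequences are closed under two operations: waiting for a time \<open>h\<close> before
  following \<open>\<sigma>\<close> (\<open>delay\<close>), and in addition firing one impulse at time \<open>h\<close> (\<open>prepend\<close>). Each is one
  particular strategy available at \<open>x\<close>, so, as in dynamic programming, its cost is at most \<open>V x\<close>.
  Taking the supremum over \<open>\<sigma>\<close>, the integral of \<open>\<parallel>S t x\<parallel>\<^sup>p\<close> over \<open>[0, h]\<close> plus \<open>V (S h x)\<close> in the
  first case, and \<open>\<parallel>S h x\<parallel>\<^sup>p + V (J (S h x))\<close> in the second, is at most \<open>V x\<close>. Letting \<open>h\<close> tend to \<open>0\<close> gives the Dini inequality and, as \<open>V\<close> is continuous, the jump inequality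
  (\<open>explicit_V_flow\<close>, \<open>explicit_V_jump\<close>); in the second case a limit is taken because an
  impulse at time \<open>0\<close> is not admissible. Finiteness, the bound \<open>V x \<le> c \<parallel>x\<parallel>\<^sup>p\<close> and the Lipschitz
  property all come from one observation: the exponential decay dominates the operator norms in the
  cost by an integrable function of time and a summable function of the impulse number that do not
  depend on \<open>\<sigma>\<close> (\<open>explicit_V_comparison\<close>).
\<close>

section \<open>Orbits of the semigroup and the evolution operators\<close>

text \<open>The uniform bound \<open>G\<close> is the part of the growth condition that concerns the flow between
  impulses. With it, the strong limit at \<open>0\<close> gives continuity of the orbits from both sides.\<close>

locale impulsive_system =
  fixes S :: "real \<Rightarrow> 'a::banach \<Rightarrow>\<^sub>L 'a" and J :: "'a \<Rightarrow>\<^sub>L 'a" and G :: real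
  assumes C0: "C0_semigroup S"
    and G_pos: "0 < G"
    and norm_S_le: "0 \<le> t \<Longrightarrow> norm (S t) \<le> G"
begin

lemma S_0 [simp]: "S 0 = id_blinfun"
  using C0 by (simp add: C0_semigroup_def)

lemma S_add: "0 \<le> s \<Longrightarrow> 0 \<le> t \<Longrightarrow> S (s + t) = S s o\<^sub>L S t"
  using C0 by (simp add: C0_semigroup_def)

lemma S_split: "s \<le> u \<Longrightarrow> u \<le> t \<Longrightarrow> S (t - s) = S (t - u) o\<^sub>L S (u - s)"
  using S_add[of "t - u" "u - s"] by simp

lemma orbit_tendsto_0: "((\<lambda>t. S t x) \<longlongrightarrow> x) (at_right 0)"
  using C0 by (simp add: C0_semigroup_def)

lemma norm_S_apply_le: "0 \<le> t \<Longrightarrow> norm (S t x) \<le> G * norm x"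
  by (meson norm_S_le norm_blinfun mult_right_mono norm_ge_zero order_trans)

text \<open>For \<open>a \<le> b\<close> the difference \<open>S b x - S a x = S a (S (b - a) x - x)\<close> is controlled by the behaviour
  of the orbit at \<open>0\<close>, uniformly in \<open>a\<close>; this handles both one-sided limits at once.\<close>

lemma continuous_on_orbit: "continuous_on {0..} (\<lambda>t. S t x)"
  unfolding continuous_on_iff
proof (intro ballI allI impI)
  fix t e :: real assume t: "t \<in> {0..}" and e: "0 < e"
  have "eventually (\<lambda>h. dist (S h x) x < e / G) (at_right 0)"
    using orbit_tendsto_0[of x] e G_pos by (auto simp: tendsto_iff)
  then obtain d where d: "d > 0" "\<And>h. 0 < h \<Longrightarrow> h < d \<Longrightarrow> dist (S h x) x < e / G"
    by (auto simp: eventually_at_right_field)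
  have *: "dist (S b x) (S a x) < e" if "0 \<le> a" "a \<le> b" "b - a < d" for a b
  proof (cases "a = b")
    case False
    have "S b x - S a x = S a (S (b - a) x - x)"
      using S_add[of a "b - a"] that by (simp add: blinfun.diff_right)
    hence "dist (S b x) (S a x) \<le> G * dist (S (b - a) x) x"
      using norm_S_apply_le[OF that(1)] by (simp add: dist_norm)
    also have "\<dots> < G * (e / G)"
      using d(2)[of "b - a"] that False G_pos by (intro mult_strict_left_mono) auto
    finally show ?thesis using G_pos by simp
  qed (use e in auto)
  have "dist (S s x) (S t x) < e" if "s \<in> {0..}" "dist s t < d" for s
    using *[of s t] *[of t s] that t by (cases "s \<le> t") (auto simp: dist_commute dist_real_def)
  with d(1) show "\<exists>d>0. \<forall>s\<in>{0..}. dist s t < d \<longrightarrow> dist (S s x) (S t x) < e"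
    by blast
qed

lemma blinfun_compose_associative: "(a o\<^sub>L b) o\<^sub>L c = a o\<^sub>L (b o\<^sub>L c)"
  by (rule blinfun_eqI) simp

text \<open>The two cocycle properties below split off a piece of free flow, at the beginning or at the end
  of the time interval.\<close>

lemma evolve_start:
  assumes "s \<le> u" "u \<le> t" "\<forall>\<tau>\<in>set \<tau>s. u \<le> \<tau>"
  shows "evolve S J t s \<tau>s = evolve S J t u \<tau>s o\<^sub>L S (u - s)"
proof (cases \<tau>s)
  case Nil
  thus ?thesis using S_split[of s u t] assms by simp
next
  case (Cons \<tau> \<tau>s')
  thus ?thesis using S_split[of s u \<tau>] assms by (auto intro!: blinfun_eqI)
qed

lemma evolve_end:
  assumes "s \<le> u" "u \<le> t" "\<forall>\<tau>\<in>set \<tau>s. \<tau> \<le> u"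
  shows "evolve S J t s \<tau>s = S (t - u) o\<^sub>L evolve S J u s \<tau>s"
  using assms
proof (induction \<tau>s arbitrary: s)
  case Nil
  thus ?case using S_split[of s u t] by simp
next
  case (Cons \<tau> \<tau>s)
  thus ?case by (auto intro!: blinfun_eqI)
qed

end

text \<open>The system is autonomous: only the distances between successive times matter.\<close>

lemma evolve_translate:
  "evolve S J (t + h) (s + h) (map (\<lambda>r. r + h) \<tau>s) = evolve S J t s \<tau>s"
  by (induction \<tau>s arbitrary: s) auto

lemma sorted_list_of_set_translate:
  assumes "finite (A :: real set)"
  shows "sorted_list_of_set ((\<lambda>r. r + h) ` A) = map (\<lambda>r. r + h) (sorted_list_of_set A)"
proof -
  have "sorted_list_of_set (set (map (\<lambda>r. r + h) (sorted_list_of_set A)))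
      = map (\<lambda>r. r + h) (sorted_list_of_set A)"
    by (intro sorted_list_of_set.idem_if_sorted_distinct)
       (auto simp: sorted_map distinct_map inj_on_def)
  with assms show ?thesis by simp
qed

section \<open>Impulse sequences, delaying and prepending\<close>

lemma impulse_seqs_strict_mono: "\<sigma> \<in> impulse_seqs \<Longrightarrow> strict_mono \<sigma>"
  by (simp add: impulse_seqs_def strict_mono_Suc_iff)

lemma impulse_seqs_nonneg: "\<sigma> \<in> impulse_seqs \<Longrightarrow> 0 \<le> \<sigma> k"
  using strict_mono_less_eq[OF impulse_seqs_strict_mono, of \<sigma> 0 k] by (simp add: impulse_seqs_def)

text \<open>Since the impulse times have no finite accumulation point, the intervals between successive
  ones exhaust the half-line; with \<open>\<sigma> 0 = 0\<close> the first interval starts at the origin.\<close>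

lemma impulse_seqs_interval:
  assumes "\<sigma> \<in> impulse_seqs" "0 \<le> t"
  obtains k where "\<sigma> k \<le> t" "t < \<sigma> (Suc k)"
proof -
  have "\<exists>k. t < \<sigma> k"
    using assms(1) eventually_happens[of "\<lambda>k. t < \<sigma> k" sequentially]
    by (auto simp: impulse_seqs_def filterlim_at_top_dense)
  then obtain k where k: "t < \<sigma> k" "\<forall>j<k. \<not> t < \<sigma> j"
    using exists_least_iff[of "\<lambda>k. t < \<sigma> k"] by blast
  with assms have "k \<noteq> 0" by (auto simp: impulse_seqs_def intro!: gr0I)
  then obtain j where "k = Suc j" by (cases k) auto
  with k show thesis by (intro that[of j]) (auto simp: not_less)
qed

lemma impulse_times_upto:
  assumes "\<sigma> \<in> impulse_seqs" "\<sigma> k \<le> t" "t < \<sigma> (Suc k)"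
  shows "impulse_times \<sigma> \<inter> {0<..t} = \<sigma> ` {1..k}"
proof -
  note sm = impulse_seqs_strict_mono[OF assms(1)]
  have "0 < \<sigma> j \<and> \<sigma> j \<le> t \<longleftrightarrow> j \<in> {1..k}" for j
  proof -
    have "0 < \<sigma> j \<longleftrightarrow> 1 \<le> j"
      using strict_mono_less[OF sm, of 0 j] assms(1) by (auto simp: impulse_seqs_def)
    moreover have "\<sigma> j \<le> t \<longleftrightarrow> j \<le> k"
      using strict_mono_less_eq[OF sm, of j k] strict_mono_less_eq[OF sm, of "Suc k" j] assms(2,3)
      by (cases "j \<le> k") auto
    ultimately show ?thesis by auto
  qed
  thus ?thesis by (auto simp: impulse_times_def)
qed

lemma finite_impulse_times: "\<sigma> \<in> impulse_seqs \<Longrightarrow> finite (impulse_times \<sigma> \<inter> {0<..t})"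
proof (cases "0 \<le> t")
  case True
  assume "\<sigma> \<in> impulse_seqs"
  then obtain k where "\<sigma> k \<le> t" "t < \<sigma> (Suc k)"
    using impulse_seqs_interval True by blast
  thus ?thesis using impulse_times_upto \<open>\<sigma> \<in> impulse_seqs\<close> by simp
qed auto

lemma impulse_count_self:
  assumes "\<sigma> \<in> impulse_seqs"
  shows "impulse_count \<sigma> (\<sigma> k) 0 = k"
proof -
  have "inj_on \<sigma> {1..k}"
    using impulse_seqs_strict_mono[OF assms] strict_mono_imp_inj_on by (blast intro: inj_on_subset)
  thus ?thesis
    using assms impulse_times_upto[OF assms, of k "\<sigma> k"]
    by (simp add: impulse_count_def card_image impulse_seqs_def)
qed

text \<open>Delaying moves the impulse times but not the convention \<open>\<sigma> 0 = 0\<close>, which is why index \<open>0\<close> is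
  treated separately. Prepending uses that convention: \<open>\<sigma> 0 + h = h\<close> becomes the first impulse
  time.\<close>

definition delay :: "real \<Rightarrow> (nat \<Rightarrow> real) \<Rightarrow> nat \<Rightarrow> real" where
  "delay h \<sigma> k = (if k = 0 then 0 else \<sigma> k + h)"

definition prepend :: "real \<Rightarrow> (nat \<Rightarrow> real) \<Rightarrow> nat \<Rightarrow> real" where
  "prepend h \<sigma> k = (case k of 0 \<Rightarrow> 0 | Suc j \<Rightarrow> \<sigma> j + h)"

lemma delay_in_impulse_seqs:
  assumes "\<sigma> \<in> impulse_seqs" "0 \<le> h"
  shows "delay h \<sigma> \<in> impulse_seqs"
proof -
  have "filterlim (\<lambda>k. h + \<sigma> k) at_top sequentially"
    using assms(1) by (intro filterlim_tendsto_add_at_top[OF tendsto_const]) (simp add: impulse_seqs_def)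
  moreover have "eventually (\<lambda>k. h + \<sigma> k = delay h \<sigma> k) sequentially"
    using eventually_gt_at_top[of 0] by eventually_elim (simp add: delay_def)
  ultimately have "filterlim (delay h \<sigma>) at_top sequentially"
    using filterlim_cong[OF refl refl, of "\<lambda>k. h + \<sigma> k" "delay h \<sigma>" sequentially at_top] by blast
  moreover have "delay h \<sigma> k < delay h \<sigma> (Suc k)" for k
    using assms strict_mono_less[OF impulse_seqs_strict_mono[OF assms(1)], of 0 "Suc 0"]
    by (auto simp: delay_def impulse_seqs_def intro: add_pos_nonneg)
  ultimately show ?thesis by (simp add: impulse_seqs_def delay_def)
qed

lemma prepend_in_impulse_seqs:
  assumes "\<sigma> \<in> impulse_seqs" "0 < h"
  shows "prepend h \<sigma> \<in> impulse_seqs"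
proof -
  have "filterlim (\<lambda>k. h + \<sigma> k) at_top sequentially"
    using assms(1) by (intro filterlim_tendsto_add_at_top[OF tendsto_const]) (simp add: impulse_seqs_def)
  hence "filterlim (\<lambda>k. prepend h \<sigma> (Suc k)) at_top sequentially"
    by (simp add: prepend_def add.commute)
  hence "filterlim (prepend h \<sigma>) at_top sequentially"
    by (simp only: filterlim_sequentially_Suc)
  moreover have "prepend h \<sigma> k < prepend h \<sigma> (Suc k)" for k
    using assms by (auto simp: prepend_def impulse_seqs_def split: nat.split)
  ultimately show ?thesis by (simp add: impulse_seqs_def prepend_def)
qed

lemma impulse_times_eq: "impulse_times \<sigma> = range (\<lambda>k. \<sigma> (Suc k))"
  unfolding impulse_times_def by (auto simp: Suc_le_eq gr0_conv_Suc)

lemma impulse_times_pos: "\<sigma> \<in> impulse_seqs \<Longrightarrow> \<tau> \<in> impulse_times \<sigma> \<Longrightarrow> 0 < \<tau>"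
  using strict_mono_less[OF impulse_seqs_strict_mono, of \<sigma> 0]
  by (auto simp: impulse_times_eq impulse_seqs_def)

lemma impulse_times_delay:
  assumes "\<sigma> \<in> impulse_seqs" "0 \<le> h"
  shows "impulse_times (delay h \<sigma>) \<inter> {0<..t + h} = (\<lambda>r. r + h) ` (impulse_times \<sigma> \<inter> {0<..t})"
proof -
  have "impulse_times (delay h \<sigma>) = (\<lambda>r. r + h) ` impulse_times \<sigma>"
    unfolding impulse_times_eq image_image by (simp add: delay_def)
  moreover have "r + h \<in> {0<..t + h} \<longleftrightarrow> r \<in> {0<..t}" if "r \<in> impulse_times \<sigma>" for r
    using impulse_times_pos[OF assms(1) that] assms(2) by auto
  ultimately show ?thesis by (auto simp del: greaterThanAtMost_iff)
qed

lemma impulse_times_prepend: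
  assumes "\<sigma> \<in> impulse_seqs" "0 < h" "0 \<le> t"
  shows "impulse_times (prepend h \<sigma>) \<inter> {0<..t + h}
       = insert h ((\<lambda>r. r + h) ` (impulse_times \<sigma> \<inter> {0<..t}))"
proof -
  have "impulse_times (prepend h \<sigma>) = (\<lambda>r. r + h) ` range \<sigma>"
    unfolding impulse_times_eq image_image by (simp add: prepend_def)
  also have "range \<sigma> = insert 0 (impulse_times \<sigma>)"
    using assms(1) unfolding impulse_times_eq
    by (subst UNIV_nat_eq) (simp add: impulse_seqs_def image_image)
  finally have "impulse_times (prepend h \<sigma>) = insert h ((\<lambda>r. r + h) ` impulse_times \<sigma>)"
    by simp
  moreover have "h \<in> {0<..t + h}" using assms(2,3) by auto
  moreover have "r + h \<in> {0<..t + h} \<longleftrightarrow> r \<in> {0<..t}" if "r \<in> impulse_times \<sigma>" for r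
    using impulse_times_pos[OF assms(1) that] assms(2) by auto
  ultimately show ?thesis by (auto simp del: greaterThanAtMost_iff)
qed

section \<open>The propagator under delaying and prepending\<close>

context impulsive_system
begin

lemma propagator_before:
  assumes "\<sigma> \<in> impulse_seqs" "0 \<le> t" "t < \<sigma> 1"
  shows "propagator S J \<sigma> t 0 = S t"
  using impulse_times_upto[of \<sigma> 0 t] assms by (simp add: propagator_def impulse_seqs_def)

lemma propagator_0: "propagator S J \<sigma> 0 0 = id_blinfun"
  by (simp add: propagator_def)

lemma propagator_between:
  assumes "\<sigma> \<in> impulse_seqs" "\<sigma> k \<le> t" "t < \<sigma> (Suc k)"
  shows "propagator S J \<sigma> t 0 = S (t - \<sigma> k) o\<^sub>L propagator S J \<sigma> (\<sigma> k) 0"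
proof -
  note sm = impulse_seqs_strict_mono[OF assms(1)]
  have "impulse_times \<sigma> \<inter> {0<..\<sigma> k} = \<sigma> ` {1..k}"
    using assms by (intro impulse_times_upto) auto
  moreover have "impulse_times \<sigma> \<inter> {0<..t} = \<sigma> ` {1..k}"
    using assms by (intro impulse_times_upto) auto
  ultimately show ?thesis
    unfolding propagator_def
    using assms impulse_seqs_nonneg[OF assms(1), of k] strict_mono_less_eq[OF sm]
    by (auto intro!: evolve_end)
qed

lemma propagator_delay:
  assumes "\<sigma> \<in> impulse_seqs" "0 \<le> h" "0 \<le> t"
  shows "propagator S J (delay h \<sigma>) (t + h) 0 = propagator S J \<sigma> t 0 o\<^sub>L S h"
proof -
  define L where "L = sorted_list_of_set (impulse_times \<sigma> \<inter> {0<..t})"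
  have pos: "\<forall>\<tau>\<in>set (map (\<lambda>r. r + h) L). h \<le> \<tau>"
    using finite_impulse_times[OF assms(1), of t] by (auto simp: L_def)
  have "propagator S J (delay h \<sigma>) (t + h) 0 = evolve S J (t + h) 0 (map (\<lambda>r. r + h) L)"
    unfolding propagator_def L_def impulse_times_delay[OF assms(1,2)]
      sorted_list_of_set_translate[OF finite_impulse_times[OF assms(1)]] ..
  also have "\<dots> = evolve S J (t + h) h (map (\<lambda>r. r + h) L) o\<^sub>L S (h - 0)"
    using assms by (intro evolve_start pos) auto
  finally show ?thesis
    using evolve_translate[of S J t h 0 L] by (simp only: add_0 propagator_def L_def diff_zero)
qed

lemma propagator_prepend:
  assumes "\<sigma> \<in> impulse_seqs" "0 < h" "0 \<le> t"
  shows "propagator S J (prepend h \<sigma>) (t + h) 0 = propagator S J \<sigma> t 0 o\<^sub>L J o\<^sub>L S h"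
proof -
  define A where "A = impulse_times \<sigma> \<inter> {0<..t}"
  define L where "L = sorted_list_of_set A"
  have fin: "finite A" using finite_impulse_times[OF assms(1)] by (simp add: A_def)
  have "sorted_list_of_set (set (h # map (\<lambda>r. r + h) L)) = h # map (\<lambda>r. r + h) L"
    using fin by (intro sorted_list_of_set.idem_if_sorted_distinct)
       (auto simp: L_def A_def sorted_map distinct_map inj_on_def)
  hence "sorted_list_of_set (insert h ((\<lambda>r. r + h) ` A)) = h # map (\<lambda>r. r + h) L"
    using fin by (simp add: L_def)
  hence "propagator S J (prepend h \<sigma>) (t + h) 0 = evolve S J (t + h) 0 (h # map (\<lambda>r. r + h) L)"
    unfolding propagator_def A_def impulse_times_prepend[OF assms] by (simp only:)
  also have "\<dots> = evolve S J (t + h) h (map (\<lambda>r. r + h) L) o\<^sub>L J o\<^sub>L S h"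
    by simp
  finally show ?thesis
    using evolve_translate[of S J t h 0 L] by (simp only: add_0 propagator_def L_def A_def)
qed

text \<open>The left limits in the cost are attained by letting the flow run up to the next impulse time
  without applying \<open>J\<close> there. This closed form (see \<open>propagator_left_eq\<close>) shows that they depend
  linearly on the initial state and how they change when the sequence is shifted.\<close>

definition pre_impulse :: "(nat \<Rightarrow> real) \<Rightarrow> nat \<Rightarrow> 'a \<Rightarrow>\<^sub>L 'a" where
  "pre_impulse \<sigma> k = S (\<sigma> (Suc k) - \<sigma> k) o\<^sub>L propagator S J \<sigma> (\<sigma> k) 0"

lemma propagator_left_eq:
  assumes "\<sigma> \<in> impulse_seqs"
  shows "propagator_left S J \<sigma> (\<sigma> (Suc k)) 0 x = pre_impulse \<sigma> k x"
proof -
  define y where "y = propagator S J \<sigma> (\<sigma> k) 0 x"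
  have less: "\<sigma> k < \<sigma> (Suc k)" using assms by (simp add: impulse_seqs_def)
  have "continuous_on {\<sigma> k..\<sigma> (Suc k)} (\<lambda>t. S (t - \<sigma> k) y)"
    by (rule continuous_on_compose2[OF continuous_on_orbit[of y]]) (auto intro!: continuous_intros)
  hence "((\<lambda>t. S (t - \<sigma> k) y) \<longlongrightarrow> S (\<sigma> (Suc k) - \<sigma> k) y) (at_left (\<sigma> (Suc k)))"
    using less by (rule continuous_on_Icc_at_leftD[where f = "\<lambda>t. S (t - \<sigma> k) y"])
  moreover have "eventually (\<lambda>t. S (t - \<sigma> k) y = propagator S J \<sigma> t 0 x) (at_left (\<sigma> (Suc k)))"
  proof (rule eventually_mono[OF eventually_at_left_real[OF less]])
    fix t assume "t \<in> {\<sigma> k<..<\<sigma> (Suc k)}"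
    thus "S (t - \<sigma> k) y = propagator S J \<sigma> t 0 x"
      using propagator_between[OF assms, of k t] by (simp add: y_def)
  qed
  ultimately have "((\<lambda>t. propagator S J \<sigma> t 0 x) \<longlongrightarrow> S (\<sigma> (Suc k) - \<sigma> k) y) (at_left (\<sigma> (Suc k)))"
    by (rule Lim_transform_eventually)
  thus ?thesis
    unfolding propagator_left_def by (subst tendsto_Lim) (auto simp: y_def pre_impulse_def)
qed

lemma pre_impulse_delay:
  assumes "\<sigma> \<in> impulse_seqs" "0 \<le> h"
  shows "pre_impulse (delay h \<sigma>) k = pre_impulse \<sigma> k o\<^sub>L S h"
proof (cases "k = 0")
  case True
  have "\<sigma> 0 = 0" using assms(1) by (simp add: impulse_seqs_def)
  moreover have "S (\<sigma> (Suc 0) + h) = S (\<sigma> (Suc 0)) o\<^sub>L S h"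
    by (rule S_add[OF impulse_seqs_nonneg[OF assms(1)] assms(2)])
  ultimately show ?thesis
    by (intro blinfun_eqI) (simp add: pre_impulse_def delay_def propagator_0 True)
next
  case False
  have "propagator S J (delay h \<sigma>) (delay h \<sigma> k) 0 = propagator S J \<sigma> (\<sigma> k) 0 o\<^sub>L S h"
    using propagator_delay[OF assms impulse_seqs_nonneg[OF assms(1), of k]] False
    by (simp only: delay_def[of h \<sigma> k] if_False)
  moreover have "delay h \<sigma> (Suc k) - delay h \<sigma> k = \<sigma> (Suc k) - \<sigma> k"
    using False by (simp add: delay_def)
  ultimately show ?thesis
    unfolding pre_impulse_def by (simp only: blinfun_compose_associative)
qed

lemma pre_impulse_prepend_0: "pre_impulse (prepend h \<sigma>) 0 = S (\<sigma> 0 + h)"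
  by (auto simp: pre_impulse_def prepend_def propagator_0 intro!: blinfun_eqI)

lemma pre_impulse_prepend_Suc:
  assumes "\<sigma> \<in> impulse_seqs" "0 < h"
  shows "pre_impulse (prepend h \<sigma>) (Suc k) = pre_impulse \<sigma> k o\<^sub>L J o\<^sub>L S h"
proof -
  have "propagator S J (prepend h \<sigma>) (prepend h \<sigma> (Suc k)) 0
      = propagator S J \<sigma> (\<sigma> k) 0 o\<^sub>L J o\<^sub>L S h"
    using propagator_prepend[OF assms impulse_seqs_nonneg[OF assms(1), of k]]
    by (simp add: prepend_def)
  moreover have "prepend h \<sigma> (Suc (Suc k)) - prepend h \<sigma> (Suc k) = \<sigma> (Suc k) - \<sigma> k"
    by (simp add: prepend_def)
  ultimately show ?thesis
    unfolding pre_impulse_def by (simp only: blinfun_compose_associative)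
qed

section \<open>The explicit functional as a value function\<close>

definition running_cost :: "real \<Rightarrow> (nat \<Rightarrow> real) \<Rightarrow> 'a \<Rightarrow> ennreal" where
  "running_cost p \<sigma> x = (\<integral>\<^sup>+t\<in>{0..}. ennreal (norm (propagator S J \<sigma> t 0 x) powr p) \<partial>lborel)"

definition jump_cost :: "real \<Rightarrow> (nat \<Rightarrow> real) \<Rightarrow> 'a \<Rightarrow> ennreal" where
  "jump_cost p \<sigma> x = (\<Sum>k. ennreal (norm (pre_impulse \<sigma> k x) powr p))"

lemma explicit_V_eq:
  "explicit_V S J p x = (SUP \<sigma>\<in>impulse_seqs. running_cost p \<sigma> x + jump_cost p \<sigma> x)"
  unfolding explicit_V_def running_cost_def jump_cost_def
  by (intro SUP_cong) (auto simp: propagator_left_eq)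

text \<open>Between two impulse times the propagator is a continuous orbit of the semigroup, and there are
  only countably many such intervals. Measurability is what makes the integral additive.\<close>

lemma running_cost_measurable:
  assumes "\<sigma> \<in> impulse_seqs"
  shows "(\<lambda>t. ennreal (norm (propagator S J \<sigma> t 0 x) powr p) * indicator {0..} t) \<in> borel_measurable borel"
    (is "?f \<in> _")
proof (rule measurable_piecewise_restrict2)
  let ?A = "\<lambda>n. case n of 0 \<Rightarrow> {..<0} | Suc k \<Rightarrow> {\<sigma> k..<\<sigma> (Suc k)}"
  show "?A n \<in> sets borel" for n by (cases n) auto
  have "t \<in> (\<Union>n. ?A n)" for t
  proof (cases "t < 0")
    case True thus ?thesis by (auto intro!: exI[of _ 0])
  next
    case False
    then obtain k where "\<sigma> k \<le> t" "t < \<sigma> (Suc k)"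
      using impulse_seqs_interval[OF assms, of t] by auto
    thus ?thesis by (auto intro!: exI[of _ "Suc k"])
  qed
  thus "space borel = (\<Union>n. ?A n)" by auto
  show "\<exists>h\<in>borel_measurable borel. \<forall>t\<in>?A n. ?f t = h t" for n
  proof (cases n)
    case 0
    thus ?thesis by (intro bexI[of _ "\<lambda>_. 0"]) auto
  next
    case (Suc k)
    \<comment> \<open>Truncating at zero extends the orbit to a continuous function on the whole line.\<close>
    let ?h = "\<lambda>t. ennreal (norm (S (max 0 (t - \<sigma> k)) (propagator S J \<sigma> (\<sigma> k) 0 x)) powr p)"
    have "continuous_on UNIV (\<lambda>t. S (max 0 (t - \<sigma> k)) (propagator S J \<sigma> (\<sigma> k) 0 x))"
      by (rule continuous_on_compose2[OF continuous_on_orbit]) (auto intro!: continuous_intros)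
    hence "(\<lambda>t. norm (S (max 0 (t - \<sigma> k)) (propagator S J \<sigma> (\<sigma> k) 0 x))) \<in> borel_measurable borel"
      by (intro borel_measurable_continuous_onI continuous_on_norm)
    hence "?h \<in> borel_measurable borel"
      by measurable
    moreover have "\<forall>t\<in>?A n. ?f t = ?h t"
    proof
      fix t assume "t \<in> ?A n"
      thus "?f t = ?h t"
        using propagator_between[OF assms, of k t] impulse_seqs_nonneg[OF assms, of k] Suc
        by (auto simp: max_def)
    qed
    ultimately show ?thesis by (intro bexI[of _ ?h])
  qed
qed

text \<open>Splitting the integral at time \<open>h\<close>: the tail is, after translation, the running cost of the
  shifted system, and the initial part is at least \<open>h\<close> times any lower bound of the integrand.
  Both delaying and prepending are instances.\<close>

lemma running_cost_shift:
  assumes "\<sigma> \<in> impulse_seqs" "\<sigma>' \<in> impulse_seqs" "0 \<le> h" "0 \<le> m"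
    and later: "\<And>t. 0 \<le> t \<Longrightarrow> propagator S J \<sigma>' (t + h) 0 x = propagator S J \<sigma> t 0 y"
    and initial: "\<And>t. 0 \<le> t \<Longrightarrow> t < h \<Longrightarrow> m \<le> norm (propagator S J \<sigma>' t 0 x) powr p"
  shows "ennreal (h * m) + running_cost p \<sigma> y \<le> running_cost p \<sigma>' x"
proof -
  define f where "f = (\<lambda>t. ennreal (norm (propagator S J \<sigma>' t 0 x) powr p) * indicator {0..} t)"
  have [measurable]: "f \<in> borel_measurable borel"
    unfolding f_def by (rule running_cost_measurable[OF assms(2)])
  have "(\<integral>\<^sup>+t. f t * indicator {h..} t \<partial>lborel)
      = (\<integral>\<^sup>+t. f (h + 1 * t) * indicator {h..} (h + 1 * t) \<partial>lborel)"
    by (subst nn_integral_real_affine[where c = 1 and t = h]) auto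
  also have "\<dots> = running_cost p \<sigma> y"
    unfolding running_cost_def f_def
    using later \<open>0 \<le> h\<close> by (intro nn_integral_cong) (auto simp: indicator_def add.commute)
  finally have tail: "(\<integral>\<^sup>+t. f t * indicator {h..} t \<partial>lborel) = running_cost p \<sigma> y" .
  have "ennreal (h * m) = (\<integral>\<^sup>+t. ennreal m * indicator {0..<h} t \<partial>lborel)"
    using assms(3,4) by (simp add: nn_integral_cmult_indicator ennreal_mult mult.commute)
  hence "ennreal (h * m) + running_cost p \<sigma> y
      = (\<integral>\<^sup>+t. ennreal m * indicator {0..<h} t + f t * indicator {h..} t \<partial>lborel)"
    by (subst nn_integral_add) (simp_all add: tail)
  also have "\<dots> \<le> (\<integral>\<^sup>+t. f t \<partial>lborel)"
    using initial by (intro nn_integral_mono) (auto simp: f_def indicator_def intro!: ennreal_leI)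
  also have "\<dots> = running_cost p \<sigma>' x" by (simp add: running_cost_def f_def)
  finally show ?thesis .
qed

lemma explicit_V_ge: "\<sigma> \<in> impulse_seqs \<Longrightarrow> running_cost p \<sigma> x + jump_cost p \<sigma> x \<le> explicit_V S J p x"
  unfolding explicit_V_eq by (rule SUP_upper)

lemma impulse_seqs_nonempty: "impulse_seqs \<noteq> {}"
proof -
  have "real \<in> impulse_seqs" by (simp add: impulse_seqs_def filterlim_real_sequentially)
  thus ?thesis by blast
qed

lemma add_explicit_V_le:
  assumes "\<And>\<sigma>. \<sigma> \<in> impulse_seqs \<Longrightarrow> c + (running_cost p \<sigma> x + jump_cost p \<sigma> x) \<le> b"
  shows "c + explicit_V S J p x \<le> b"
  unfolding explicit_V_eq using assms impulse_seqs_nonempty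
  by (auto simp: ennreal_SUP_add_right intro: SUP_least)

text \<open>Half of the dynamic programming principle: waiting for time \<open>h\<close> and then following any \<open>\<sigma>\<close> is
  itself an admissible strategy at \<open>x\<close>.\<close>

lemma explicit_V_flow:
  assumes "0 \<le> h" "0 \<le> m" "\<And>t. 0 \<le> t \<Longrightarrow> t < h \<Longrightarrow> m \<le> norm (S t x) powr p"
  shows "ennreal (h * m) + explicit_V S J p (S h x) \<le> explicit_V S J p x"
proof (rule add_explicit_V_le)
  fix \<sigma> assume \<sigma>: "\<sigma> \<in> impulse_seqs"
  note \<sigma>' = delay_in_impulse_seqs[OF \<sigma> assms(1)]
  have "ennreal (h * m) + running_cost p \<sigma> (S h x) \<le> running_cost p (delay h \<sigma>) x"
  proof (rule running_cost_shift[OF \<sigma> \<sigma>' assms(1,2)])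
    fix t assume t: "0 \<le> t" "t < h"
    hence "t < delay h \<sigma> 1" using impulse_seqs_nonneg[OF \<sigma>, of 1] by (simp add: delay_def)
    thus "m \<le> norm (propagator S J (delay h \<sigma>) t 0 x) powr p"
      using propagator_before[OF \<sigma>' t(1)] assms(3) t by simp
  qed (use \<sigma> assms in \<open>simp add: propagator_delay\<close>)
  moreover have "jump_cost p (delay h \<sigma>) x = jump_cost p \<sigma> (S h x)"
    using \<sigma> assms(1) by (simp add: jump_cost_def pre_impulse_delay)
  ultimately have "ennreal (h * m) + running_cost p \<sigma> (S h x) + jump_cost p \<sigma> (S h x)
      \<le> running_cost p (delay h \<sigma>) x + jump_cost p (delay h \<sigma>) x"
    by (intro add_mono) auto
  also note explicit_V_ge[OF \<sigma>']
  finally show "ennreal (h * m) + (running_cost p \<sigma> (S h x) + jump_cost p \<sigma> (S h x))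
      \<le> explicit_V S J p x"
    by (simp add: add.assoc)
qed

text \<open>The same for the strategy that fires an impulse at time \<open>h\<close>, whose left limit \<open>S h x\<close>
  contributes the new term of the series. The integral over \<open>[0, h]\<close> is discarded, as it vanishes
  in the limit in which this estimate is used.\<close>

lemma explicit_V_jump:
  assumes "0 < h"
  shows "ennreal (norm (S h x) powr p) + explicit_V S J p (J (S h x)) \<le> explicit_V S J p x"
proof (rule add_explicit_V_le)
  fix \<sigma> assume \<sigma>: "\<sigma> \<in> impulse_seqs"
  note \<sigma>' = prepend_in_impulse_seqs[OF \<sigma> assms]
  let ?c = "ennreal (norm (S h x) powr p)" and ?y = "J (S h x)"
  have "ennreal (h * 0) + running_cost p \<sigma> ?y \<le> running_cost p (prepend h \<sigma>) x"
  proof (rule running_cost_shift[OF \<sigma> \<sigma>'])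
    show "propagator S J (prepend h \<sigma>) (t + h) 0 x = propagator S J \<sigma> t 0 ?y" if "0 \<le> t" for t
      by (simp add: propagator_prepend[OF \<sigma> assms that])
  qed (use assms in simp_all)
  moreover have "jump_cost p (prepend h \<sigma>) x = ?c + jump_cost p \<sigma> ?y"
  proof -
    have "pre_impulse (prepend h \<sigma>) 0 = S h"
      using \<sigma> by (simp add: pre_impulse_prepend_0 impulse_seqs_def)
    hence "(\<Sum>j<1. ennreal (norm (pre_impulse (prepend h \<sigma>) j x) powr p)) = ?c"
      by simp
    moreover have "(\<Sum>j. ennreal (norm (pre_impulse (prepend h \<sigma>) (j + 1) x) powr p))
        = jump_cost p \<sigma> ?y"
      unfolding jump_cost_def Suc_eq_plus1[symmetric]
      by (simp only: pre_impulse_prepend_Suc[OF \<sigma> assms] blinfun_compose.rep_eq o_apply)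
    ultimately show ?thesis
      unfolding jump_cost_def[of p "prepend h \<sigma>"]
      by (subst suminf_offset[of _ 1]) (auto simp: add.commute intro: summableI)
  qed
  ultimately have "running_cost p \<sigma> ?y + (?c + jump_cost p \<sigma> ?y)
      \<le> running_cost p (prepend h \<sigma>) x + jump_cost p (prepend h \<sigma>) x"
    by (intro add_mono) auto
  also note explicit_V_ge[OF \<sigma>']
  finally have "running_cost p \<sigma> ?y + (?c + jump_cost p \<sigma> ?y) \<le> explicit_V S J p x" .
  thus "?c + (running_cost p \<sigma> ?y + jump_cost p \<sigma> ?y) \<le> explicit_V S J p x"
    by (simp add: ac_simps)
qed

end

section \<open>Analytic estimates\<close>

lemma powr_le_powr_plus_diff:
  fixes a b R p :: real
  assumes "0 \<le> a" "0 \<le> b" "a \<le> R" "1 \<le> p"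
  shows "a powr p \<le> b powr p + p * R powr (p - 1) * \<bar>a - b\<bar>"
proof (cases "a \<le> b")
  case True
  thus ?thesis using assms powr_mono2[of p a b] by (simp add: add_increasing2)
next
  case False
  hence less: "b < a" by simp
  have "\<exists>z\<ge>0. z \<le> a \<and> a powr p - b powr p \<le> p * z powr (p - 1) * (a - b)"
  proof (cases "b = 0")
    case True
    have "a powr p = a powr (p - 1) * a"
      using less True by (simp add: powr_diff)
    also have "\<dots> \<le> p * (a powr (p - 1) * a)"
      using assms by (intro mult_right_mono[of 1 p, simplified]) auto
    finally show ?thesis using True less by (intro exI[of _ a]) (auto simp: mult.assoc)
  next
    case False
    have "\<exists>z>b. z < a \<and> a powr p - b powr p = (a - b) * (p * z powr (p - 1))"
      using False assms by (intro MVT2 less has_real_derivative_powr) auto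
    then obtain z where "b < z" "z < a" "a powr p - b powr p = (a - b) * (p * z powr (p - 1))"
      by blast
    thus ?thesis using assms(2) by (intro exI[of _ z]) (auto simp: mult_ac)
  qed
  then obtain z where z: "0 \<le> z" "z \<le> a" "a powr p - b powr p \<le> p * z powr (p - 1) * (a - b)"
    by blast
  have "p * z powr (p - 1) * (a - b) \<le> p * R powr (p - 1) * (a - b)"
    using z assms less by (intro mult_right_mono mult_left_mono powr_mono2) auto
  thus ?thesis using z less by simp
qed

text \<open>The mean value estimate for \<open>p\<close>-th powers of norms. The operator enters only through the factor
  \<open>D powr p\<close>: precisely the quantity that can be integrated over time and summed over impulses.\<close>

lemma norm_blinfun_powr_le:
  fixes U :: "'a::real_normed_vector \<Rightarrow>\<^sub>L 'b::real_normed_vector"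
  assumes "norm U \<le> D" "0 < D" "norm x \<le> r" "0 \<le> r" "1 \<le> p"
  shows "norm (U x) powr p \<le> norm (U y) powr p + p * r powr (p - 1) * norm (x - y) * D powr p"
proof -
  have U: "norm (U z) \<le> D * norm z" for z
    using norm_blinfun[of U z] mult_right_mono[OF assms(1), of "norm z"] by simp
  have "norm (U x) \<le> D * r"
    using U[of x] mult_left_mono[OF assms(3), of D] assms(2) by linarith
  hence "norm (U x) powr p
      \<le> norm (U y) powr p + p * (D * r) powr (p - 1) * \<bar>norm (U x) - norm (U y)\<bar>"
    using assms by (intro powr_le_powr_plus_diff) auto
  also have "\<bar>norm (U x) - norm (U y)\<bar> \<le> D * norm (x - y)"
    using norm_triangle_ineq3[of "U x" "U y"] U[of "x - y"] by (simp add: blinfun.diff_right)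
  also have "(D * r) powr (p - 1) = D powr (p - 1) * r powr (p - 1)"
    using assms by (simp add: powr_mult)
  also have "p * (D powr (p - 1) * r powr (p - 1)) * (D * norm (x - y))
      = p * r powr (p - 1) * norm (x - y) * D powr p"
    using assms by (simp add: powr_diff)
  finally show ?thesis using assms by (simp add: mult_left_mono)
qed

lemma lipschitz_on_bounded_isCont:
  assumes "lipschitz_on_bounded V"
  shows "isCont V x"
proof -
  define r where "r = norm x + 1"
  have "r > 0" by (simp add: r_def add_nonneg_pos)
  with assms obtain L where L: "L > 0" "\<And>y z. norm y < r \<Longrightarrow> norm z < r \<Longrightarrow> \<bar>V y - V z\<bar> \<le> L * norm (y - z)"
    unfolding lipschitz_on_bounded_def by metis
  have "eventually (\<lambda>y. norm y < r) (at x)"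
    by (rule order_tendstoD[OF tendsto_norm[OF tendsto_ident_at]]) (simp add: r_def)
  hence ev: "eventually (\<lambda>y. norm (V y - V x) \<le> L * norm (y - x)) (at x)"
    by eventually_elim (use L(2) in \<open>simp add: r_def\<close>)
  have "((\<lambda>y. L * norm (y - x)) \<longlongrightarrow> L * norm (x - x)) (at x)"
    by (intro tendsto_intros)
  hence "((\<lambda>y. V y - V x) \<longlongrightarrow> 0) (at x)"
    by (intro Lim_null_comparison[OF ev]) simp
  thus ?thesis by (simp add: isCont_def LIM_zero_iff)
qed

lemma nn_integral_exp_finite:
  fixes C a :: real
  assumes "0 \<le> C" "0 < a"
  shows "(\<integral>\<^sup>+t\<in>{0..}. ennreal (C * exp (- a * t)) \<partial>lborel) < \<infinity>"
proof -
  have "((\<lambda>t. - (C / a) * exp (- a * t)) \<longlongrightarrow> - (C / a) * 0) at_top"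
  proof (intro tendsto_mult tendsto_const)
    have "filterlim (\<lambda>t. a * t) at_top at_top"
      using assms(2) by (intro filterlim_tendsto_pos_mult_at_top[OF tendsto_const]) (auto simp: filterlim_ident)
    hence "filterlim (\<lambda>t. - a * t) at_bot at_top"
      by (simp add: filterlim_uminus_at_top)
    thus "((\<lambda>t. exp (- a * t)) \<longlongrightarrow> 0) at_top"
      by (rule filterlim_compose[OF exp_at_bot])
  qed
  hence "(\<integral>\<^sup>+t\<in>{0..}. ennreal (C * exp (- a * t)) \<partial>lborel) = ennreal (- (C / a) * 0 - (- (C / a) * exp (- a * 0)))"
    using assms by (intro nn_integral_FTC_atLeast) (auto intro!: derivative_eq_intros)
  thus ?thesis by simp
qed

context impulsive_system
begin

section \<open>Stability makes the explicit functional a Lyapunov functional\<close>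

text \<open>An upper bound, uniform over all impulse sequences, for the cost with operator norms in place of
  norms of states: \<open>M\<close>, \<open>\<alpha>\<close>, \<open>\<rho>\<close> are the constants of the decay estimate. The integral uses only its decay in time and the
  series only its decay in the number of impulses; the factor \<open>G\<close> accounts for the last piece of
  flow in \<open>pre_impulse\<close>.\<close>

definition cost_weight :: "real \<Rightarrow> real \<Rightarrow> real \<Rightarrow> real \<Rightarrow> ennreal" where
  "cost_weight p M \<alpha> \<rho> =
     (\<integral>\<^sup>+t\<in>{0..}. ennreal ((M * exp (- \<alpha> * t)) powr p) \<partial>lborel) + (\<Sum>k. ennreal ((G * M * \<rho> ^ k) powr p))"

lemma cost_weight_finite:
  assumes "0 < M" "0 < \<alpha>" "0 < \<rho>" "\<rho> < 1" "0 < p"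
  shows "cost_weight p M \<alpha> \<rho> < \<infinity>"
proof -
  have "(M * exp (- \<alpha> * t)) powr p = M powr p * exp (- (\<alpha> * p) * t)" for t
    using assms by (simp add: powr_mult exp_powr_real algebra_simps)
  hence "(\<integral>\<^sup>+t\<in>{0..}. ennreal ((M * exp (- \<alpha> * t)) powr p) \<partial>lborel) < \<infinity>"
    using nn_integral_exp_finite[of "M powr p" "\<alpha> * p"] assms by simp
  moreover have "(\<Sum>k. ennreal ((G * M * \<rho> ^ k) powr p)) \<noteq> top"
  proof (rule ennreal_suminf_neq_top)
    have "(G * M * \<rho> ^ k) powr p = (G * M) powr p * (\<rho> powr p) ^ k" for k
      using assms G_pos by (simp add: powr_mult powr_powr mult.commute flip: powr_realpow)
    moreover have "\<rho> powr p < 1"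
      using powr_less_mono2[of p \<rho> 1] assms by simp
    hence "summable (\<lambda>k. (G * M) powr p * (\<rho> powr p) ^ k)"
      by (intro summable_mult summable_geometric) simp
    ultimately show "summable (\<lambda>k. (G * M * \<rho> ^ k) powr p)" by simp
  qed simp
  ultimately show ?thesis by (simp add: cost_weight_def less_top)
qed

text \<open>A comparison of the states \<open>x\<close> and \<open>y\<close> that holds under every bounded operator, with an error
  proportional to \<open>D powr p\<close>, carries over to the functional. Taking \<open>y = 0\<close> gives the upper bound for
  \<open>V\<close>, taking \<open>x\<close> and \<open>y\<close> in a ball gives the Lipschitz estimate.\<close>

lemma explicit_V_comparison:
  assumes uges: "\<And>\<sigma> t s. \<sigma> \<in> impulse_seqs \<Longrightarrow> 0 \<le> s \<Longrightarrow> s \<le> t \<Longrightarrow>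
      norm (propagator S J \<sigma> t s) \<le> M * \<rho> ^ impulse_count \<sigma> t s * exp (- \<alpha> * (t - s))"
    and M: "0 < M" "0 < \<alpha>" "0 < \<rho>" "\<rho> < 1"
    and c: "0 \<le> c"
    and comparison: "\<And>(U :: 'a \<Rightarrow>\<^sub>L 'a) D. norm U \<le> D \<Longrightarrow> 0 < D \<Longrightarrow>
      norm (blinfun_apply U x) powr p \<le> norm (blinfun_apply U y) powr p + c * D powr p"
  shows "explicit_V S J p x \<le> explicit_V S J p y + ennreal c * cost_weight p M \<alpha> \<rho>"
  unfolding explicit_V_eq[of p x]
proof (rule SUP_least)
  fix \<sigma> assume \<sigma>: "\<sigma> \<in> impulse_seqs"
  let ?E = "\<lambda>t. M * exp (- \<alpha> * t)"
  have ennreal_comparison: "ennreal (norm (U x) powr p) \<le> ennreal (norm (U y) powr p) + ennreal c * ennreal (D powr p)"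
    if "norm U \<le> D" "0 < D" for U :: "'a \<Rightarrow>\<^sub>L 'a" and D
    using ennreal_leI[OF comparison[OF that]] c by (simp add: ennreal_mult)
  have "running_cost p \<sigma> x \<le> running_cost p \<sigma> y +
      ennreal c * (\<integral>\<^sup>+t\<in>{0..}. ennreal (?E t powr p) \<partial>lborel)"
  proof -
    have "running_cost p \<sigma> x \<le> (\<integral>\<^sup>+t. ennreal (norm (propagator S J \<sigma> t 0 y) powr p) * indicator {0..} t
        + ennreal c * (ennreal (?E t powr p) * indicator {0..} t) \<partial>lborel)"
      unfolding running_cost_def
    proof (rule nn_integral_mono)
      fix t :: real
      show "ennreal (norm (propagator S J \<sigma> t 0 x) powr p) * indicator {0..} t
        \<le> ennreal (norm (propagator S J \<sigma> t 0 y) powr p) * indicator {0..} t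
        + ennreal c * (ennreal (?E t powr p) * indicator {0..} t)"
      proof (cases "0 \<le> t")
        case True
        have "\<rho> ^ impulse_count \<sigma> t 0 \<le> 1" using M by (intro power_le_one) auto
        hence "M * \<rho> ^ impulse_count \<sigma> t 0 * exp (- \<alpha> * t) \<le> M * 1 * exp (- \<alpha> * t)"
          using M by (intro mult_right_mono mult_left_mono) auto
        hence "norm (propagator S J \<sigma> t 0) \<le> ?E t"
          using uges[OF \<sigma>, of 0 t] True by simp
        from ennreal_comparison[OF this] show ?thesis using True M by simp
      qed auto
    qed
    also have "\<dots> = running_cost p \<sigma> y + ennreal c * (\<integral>\<^sup>+t\<in>{0..}. ennreal (?E t powr p) \<partial>lborel)"
      using running_cost_measurable[OF \<sigma>, of y p]
      by (subst nn_integral_add) (auto simp: running_cost_def nn_integral_cmult)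
    finally show ?thesis .
  qed
  moreover have "jump_cost p \<sigma> x \<le> jump_cost p \<sigma> y + ennreal c * (\<Sum>k. ennreal ((G * M * \<rho> ^ k) powr p))"
  proof -
    have "norm (pre_impulse \<sigma> k) \<le> G * M * \<rho> ^ k" for k
    proof -
      have "norm (propagator S J \<sigma> (\<sigma> k) 0) \<le> M * \<rho> ^ k * exp (- \<alpha> * \<sigma> k)"
        using uges[OF \<sigma>, of 0 "\<sigma> k"] impulse_seqs_nonneg[OF \<sigma>, of k] by (simp add: impulse_count_self[OF \<sigma>])
      also have "\<dots> \<le> M * \<rho> ^ k * 1"
        using M impulse_seqs_nonneg[OF \<sigma>, of k] by (intro mult_left_mono) auto
      finally have "norm (S (\<sigma> (Suc k) - \<sigma> k)) * norm (propagator S J \<sigma> (\<sigma> k) 0) \<le> G * (M * \<rho> ^ k)"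
        using \<sigma> G_pos by (intro mult_mono norm_S_le) (auto simp: impulse_seqs_def less_imp_le)
      thus ?thesis
        unfolding pre_impulse_def using norm_blinfun_compose order_trans by (fastforce simp: mult.assoc)
    qed
    hence "jump_cost p \<sigma> x \<le> (\<Sum>k. ennreal (norm (pre_impulse \<sigma> k y) powr p)
        + ennreal c * ennreal ((G * M * \<rho> ^ k) powr p))"
      unfolding jump_cost_def using M G_pos by (intro suminf_le ennreal_comparison summableI) auto
    also have "\<dots> = jump_cost p \<sigma> y + ennreal c * (\<Sum>k. ennreal ((G * M * \<rho> ^ k) powr p))"
      unfolding jump_cost_def by (subst suminf_add[symmetric]) (auto intro: summableI)
    finally show ?thesis .
  qed
  ultimately have "running_cost p \<sigma> x + jump_cost p \<sigma> x
      \<le> (running_cost p \<sigma> y + jump_cost p \<sigma> y) + ennreal c * cost_weight p M \<alpha> \<rho>"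
    unfolding cost_weight_def distrib_left using add_mono by (fastforce simp: ac_simps)
  also have "\<dots> \<le> explicit_V S J p y + ennreal c * cost_weight p M \<alpha> \<rho>"
    by (intro add_right_mono explicit_V_ge \<sigma>)
  finally show "running_cost p \<sigma> x + jump_cost p \<sigma> x \<le> explicit_V S J p y + ennreal c * cost_weight p M \<alpha> \<rho>" .
qed

lemma explicit_V_0: "explicit_V S J p 0 = 0"
  by (simp add: explicit_V_eq running_cost_def jump_cost_def impulse_seqs_nonempty)

lemma explicit_V_lyapunov:
  assumes "strong_UGES S J impulse_seqs" "1 \<le> p"
  shows "(\<forall>x. explicit_V S J p x < \<infinity>) \<and>
         (\<exists>c>0. lyapunov_functional S J c p (\<lambda>x. enn2real (explicit_V S J p x)))"
proof -
  obtain M \<alpha> \<rho> where M: "1 \<le> M" "0 < \<alpha>" "0 < \<rho>" "\<rho> < 1"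
    and uges: "\<And>\<sigma> t s. \<sigma> \<in> impulse_seqs \<Longrightarrow> 0 \<le> s \<Longrightarrow> s \<le> t \<Longrightarrow>
      norm (propagator S J \<sigma> t s) \<le> M * \<rho> ^ impulse_count \<sigma> t s * exp (- \<alpha> * (t - s))"
    using assms(1) unfolding strong_UGES_def by blast
  define W where "W = enn2real (cost_weight p M \<alpha> \<rho>)"
  define V where "V = (\<lambda>x. enn2real (explicit_V S J p x))"
  have "cost_weight p M \<alpha> \<rho> < \<infinity>" using M assms(2) by (intro cost_weight_finite) auto
  hence weight: "cost_weight p M \<alpha> \<rho> = ennreal W" by (simp add: W_def)
  have W: "0 \<le> W" by (simp add: W_def)
  have comparison: "explicit_V S J p x \<le> explicit_V S J p y + ennreal (c * W)"
    if "0 \<le> c" "\<And>(U :: 'a \<Rightarrow>\<^sub>L 'a) D. norm U \<le> D \<Longrightarrow> 0 < D \<Longrightarrow>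
      norm (blinfun_apply U x) powr p \<le> norm (blinfun_apply U y) powr p + c * D powr p" for x y c
    using explicit_V_comparison[OF uges _ M(2-4) that] M(1) that(1) W by (simp add: weight ennreal_mult)
  have bound: "explicit_V S J p x \<le> ennreal (norm x powr p * W)" for x
  proof -
    have "norm (U x) powr p \<le> norm (U 0) powr p + norm x powr p * D powr p"
      if "norm U \<le> D" "0 < D" for U :: "'a \<Rightarrow>\<^sub>L 'a" and D
    proof -
      have "norm (U x) \<le> norm x * D"
        using norm_blinfun[of U x] mult_right_mono[OF that(1), of "norm x"] by (simp add: mult.commute)
      hence "norm (U x) powr p \<le> (norm x * D) powr p"
        using assms(2) by (intro powr_mono2) auto
      thus ?thesis using that(2) by (simp add: powr_mult)
    qed
    from comparison[OF _ this] show ?thesis by (simp add: explicit_V_0)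
  qed
  have finite: "explicit_V S J p x < \<infinity>" for x
    using bound[of x] by (auto intro: order.strict_trans1)
  hence V: "explicit_V S J p x = ennreal (V x)" for x by (simp add: V_def)
  have V_nonneg: "0 \<le> V x" for x by (simp add: V_def)
  have V_lip: "V x \<le> V y + p * r powr (p - 1) * W * norm (x - y)" if "norm x \<le> r" "0 \<le> r" for x y r
  proof -
    have "explicit_V S J p x \<le> explicit_V S J p y + ennreal (p * r powr (p - 1) * norm (x - y) * W)"
      using that assms(2) by (intro comparison norm_blinfun_powr_le) auto
    thus ?thesis using V_nonneg assms(2) W by (simp add: V ennreal_plus[symmetric] mult_ac del: ennreal_plus)
  qed
  have lip: "lipschitz_on_bounded V"
    unfolding lipschitz_on_bounded_def
  proof (intro allI impI)
    fix r :: real assume "0 < r"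
    let ?L = "p * r powr (p - 1) * W"
    have "\<bar>V x - V y\<bar> \<le> (?L + 1) * norm (x - y)" if "norm x < r" "norm y < r" for x y
    proof -
      have "\<bar>V x - V y\<bar> \<le> ?L * norm (x - y)"
        using V_lip[of x r y] V_lip[of y r x] that \<open>0 < r\<close> by (simp add: norm_minus_commute abs_le_iff)
      thus ?thesis by (simp add: distrib_right add_increasing2)
    qed
    moreover have "0 < ?L + 1" using W assms(2) by (intro add_nonneg_pos) auto
    ultimately show "\<exists>L>0. \<forall>x y. norm x < r \<and> norm y < r \<longrightarrow> \<bar>V x - V y\<bar> \<le> L * norm (x - y)"
      by blast
  qed
  have orbit_powr: "((\<lambda>t. norm (S t x) powr p) \<longlongrightarrow> norm x powr p) (at_right 0)" for x
    using assms(2) by (intro tendsto_powr' tendsto_norm orbit_tendsto_0 tendsto_const) auto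
  have flow: "lower_right_Dini S V x \<le> ereal (- (norm x powr p))" for x
  proof (rule ereal_le_epsilon2)
    fix e :: real assume "0 < e"
    \<comment> \<open>The truncation at zero keeps the lower bound meaningful in the extended nonnegative reals.\<close>
    define m where "m = max 0 (norm x powr p - e)"
    have "eventually (\<lambda>t. norm x powr p - e < norm (S t x) powr p) (at_right 0)"
      using \<open>0 < e\<close> by (intro order_tendstoD(1)[OF orbit_powr]) auto
    then obtain d where d: "0 < d" "\<And>t. 0 < t \<Longrightarrow> t < d \<Longrightarrow> norm x powr p - e < norm (S t x) powr p"
      by (auto simp: eventually_at_right_field)
    have "(V (S h x) - V x) / h \<le> - (norm x powr p) + e" if h: "0 < h" "h < d" for h
    proof -
      have "m \<le> norm (S t x) powr p" if "0 \<le> t" "t < h" for t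
        using d(2)[of t] h that \<open>0 < e\<close> by (cases "t = 0") (auto simp: m_def)
      hence "ennreal (h * m) + explicit_V S J p (S h x) \<le> explicit_V S J p x"
        using h by (intro explicit_V_flow) (auto simp: m_def)
      hence "h * m + V (S h x) \<le> V x"
        using h V_nonneg by (simp add: V m_def ennreal_plus[symmetric] del: ennreal_plus)
      hence "(V (S h x) - V x) / h \<le> - m" using h by (simp add: field_simps)
      also have "- m \<le> - (norm x powr p) + e" by (simp add: m_def)
      finally show ?thesis .
    qed
    hence "eventually (\<lambda>h. ereal ((V (S h x) - V x) / h) \<le> ereal (- (norm x powr p) + e)) (at_right 0)"
      using d(1) by (auto simp: eventually_at_right_field)
    hence "Limsup (at_right 0) (\<lambda>h. ereal ((V (S h x) - V x) / h)) \<le> ereal (- (norm x powr p) + e)"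
      by (rule Limsup_bounded)
    thus "lower_right_Dini S V x \<le> ereal (- (norm x powr p)) + ereal e"
      unfolding lower_right_Dini_def by (simp add: order_trans[OF Liminf_le_Limsup])
  qed
  have jump: "V (J x) - V x \<le> - (norm x powr p)" for x
  proof -
    have "((\<lambda>h. V (J (S h x))) \<longlongrightarrow> V (J x)) (at_right 0)"
      by (intro isCont_tendsto_compose[OF lipschitz_on_bounded_isCont[OF lip]] blinfun.tendsto
          tendsto_const orbit_tendsto_0)
    hence "((\<lambda>h. norm (S h x) powr p + V (J (S h x))) \<longlongrightarrow> norm x powr p + V (J x)) (at_right 0)"
      by (intro tendsto_add orbit_powr)
    moreover have "norm (S h x) powr p + V (J (S h x)) \<le> V x" if "0 < h" for h
      using explicit_V_jump[OF that, of x p] V_nonneg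
      by (simp add: V ennreal_plus[symmetric] del: ennreal_plus)
    hence "eventually (\<lambda>h. norm (S h x) powr p + V (J (S h x)) \<le> V x) (at_right 0)"
      using eventually_at_right_less by (rule eventually_mono[rotated])
    ultimately have "norm x powr p + V (J x) \<le> V x"
      by (rule tendsto_upperbound) simp
    thus ?thesis by simp
  qed
  have "V x \<le> (W + 1) * norm x powr p" for x
  proof -
    have "V x \<le> norm x powr p * W" using bound[of x] W by (simp add: V)
    also have "\<dots> \<le> (W + 1) * norm x powr p"
      unfolding mult.commute[of _ W] by (intro mult_right_mono) auto
    finally show ?thesis .
  qed
  hence "lyapunov_functional S J (W + 1) p V"
    using V_nonneg lip flow jump by (auto simp: lyapunov_functional_def)
  moreover have "0 < W + 1" using W by simp
  ultimately show ?thesis using finite unfolding V_def by blast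
qed

end

section \<open>A Lyapunov functional forces stability\<close>

text \<open>A lower Dini derivative controls the difference quotients only along some sequence of step
  sizes, so decay cannot be propagated step by step. Instead, look at the last time \<open>\<tau>\<close> at which \<open>v\<close>
  lies on or below the comparison curve \<open>w\<close>: from \<open>\<tau>\<close> on, all difference quotients of \<open>v\<close> are at least
  those of \<open>w\<close>, hence at least \<open>- b * w \<tau>\<close>, and the Dini inequality at \<open>\<tau>\<close> fails. The strict inequality
  \<open>b < a\<close> leaves the room for this contradiction; any fixed fraction of the rate \<open>a\<close> is as good as
  \<open>a\<close> itself when only exponential decay is wanted.\<close>

lemma exponential_decay_of_Dini:
  fixes v :: "real \<Rightarrow> real"
  assumes cont: "continuous_on {0..T} v" and "0 \<le> T" and "b < a" and "0 < v 0"
    and Dini: "\<And>t. 0 \<le> t \<Longrightarrow> t < T \<Longrightarrow>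
      Liminf (at_right 0) (\<lambda>h. ereal ((v (t + h) - v t) / h)) \<le> ereal (- a * v t)"
  shows "v T \<le> v 0 * exp (- b * T)"
proof (rule ccontr)
  define w where "w = (\<lambda>t. v 0 * exp (- b * t))"
  assume "\<not> v T \<le> v 0 * exp (- b * T)"
  hence T: "w T < v T" by (simp add: w_def)
  have cont_diff: "continuous_on {0..T} (\<lambda>t. v t - w t)"
    unfolding w_def by (intro continuous_intros cont)
  define A where "A = {t\<in>{0..T}. v t - w t \<le> 0}"
  define \<tau> where "\<tau> = Sup A"
  have "closed A"
  proof -
    have "A = {0..T} \<inter> (\<lambda>t. v t - w t) -` {..0}" by (auto simp: A_def)
    thus ?thesis using continuous_closed_preimage[OF cont_diff] by simp
  qed
  moreover have "0 \<in> A" using \<open>0 \<le> T\<close> by (simp add: A_def w_def)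
  moreover have bdd: "bdd_above A" by (auto simp: A_def bdd_above_def)
  ultimately have "\<tau> \<in> A" unfolding \<tau>_def by (intro closed_contains_Sup) auto
  hence \<tau>: "0 \<le> \<tau>" "\<tau> \<le> T" "v \<tau> \<le> w \<tau>" by (auto simp: A_def)
  have "\<tau> < T" using \<tau> T by (cases "\<tau> = T") auto
  have above: "w t < v t" if "\<tau> < t" "t \<le> T" for t
    using cSup_upper[OF _ bdd, of t] that \<tau>(1) unfolding \<tau>_def[symmetric] by (force simp: A_def)
  have "((\<lambda>t. v t - w t) \<longlongrightarrow> v \<tau> - w \<tau>) (at_right \<tau>)"
  proof (rule continuous_on_Icc_at_rightD[where f = "\<lambda>t. v t - w t"])
    show "continuous_on {\<tau>..T} (\<lambda>t. v t - w t)"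
      using cont_diff by (rule continuous_on_subset) (use \<tau> in auto)
  qed fact
  moreover have "eventually (\<lambda>t. 0 \<le> v t - w t) (at_right \<tau>)"
    using eventually_at_right_real[OF \<open>\<tau> < T\<close>] by eventually_elim (use above in force)
  ultimately have "0 \<le> v \<tau> - w \<tau>" by (rule tendsto_lowerbound) simp
  with \<tau> have eq: "v \<tau> = w \<tau>" by simp
  have pos: "0 < w \<tau>" using \<open>0 < v 0\<close> by (simp add: w_def)
  have "- b * w \<tau> \<le> (v (\<tau> + h) - v \<tau>) / h" if h: "0 < h" "h < T - \<tau>" for h
  proof -
    have "w \<tau> * (1 + - b * h) \<le> w \<tau> * exp (- b * h)"
      using pos by (intro mult_left_mono exp_ge_add_one_self) auto
    also have "\<dots> = w (\<tau> + h)" by (simp add: w_def exp_add[symmetric] algebra_simps)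
    also have "\<dots> \<le> v (\<tau> + h)" using above[of "\<tau> + h"] h by simp
    finally show ?thesis using h eq by (simp add: field_simps)
  qed
  hence "eventually (\<lambda>h. ereal (- b * w \<tau>) \<le> ereal ((v (\<tau> + h) - v \<tau>) / h)) (at_right 0)"
    using \<open>\<tau> < T\<close> by (auto simp: eventually_at_right_field intro!: exI[of _ "T - \<tau>"])
  hence "ereal (- b * w \<tau>) \<le> Liminf (at_right 0) (\<lambda>h. ereal ((v (\<tau> + h) - v \<tau>) / h))"
    by (rule Liminf_bounded)
  also have "\<dots> \<le> ereal (- a * w \<tau>)" using Dini[OF \<tau>(1) \<open>\<tau> < T\<close>] eq by simp
  finally show False using pos \<open>b < a\<close> by simp
qed

context impulsive_system
begin

context
  fixes c p :: real and V :: "'a \<Rightarrow> real"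
  assumes c: "0 < c" and p: "1 \<le> p" and V: "lyapunov_functional S J c p V"
begin

lemma lyapunov_coercive: "norm x powr p \<le> V x"
proof -
  have "0 \<le> V (J x)" "V (J x) - V x \<le> - (norm x powr p)"
    using V by (auto simp: lyapunov_functional_def)
  thus ?thesis by linarith
qed

lemma lyapunov_upper: "V x \<le> c * norm x powr p"
  using V by (simp add: lyapunov_functional_def)

text \<open>The rate \<open>1/c\<close> is suggested by \<open>V \<le> c \<parallel>x\<parallel>\<^sup>p\<close>; half of it is attained.\<close>

lemma lyapunov_flow_decay:
  assumes "0 \<le> t"
  shows "V (S t x) \<le> V x * exp (- (1 / (2 * c)) * t)"
proof (cases "x = 0")
  case True
  have "V 0 = 0"
    using lyapunov_upper[of 0] lyapunov_coercive[of 0] by simp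
  thus ?thesis by (simp add: True)
next
  case False
  have lip: "lipschitz_on_bounded V" using V by (simp add: lyapunov_functional_def)
  have "continuous_on UNIV V"
    using lipschitz_on_bounded_isCont[OF lip] by (simp add: continuous_on_eq_continuous_at)
  hence cont: "continuous_on {0..t} (\<lambda>s. V (S s x))"
    by (rule continuous_on_compose2) (auto intro: continuous_on_subset[OF continuous_on_orbit])
  have Dini: "Liminf (at_right 0) (\<lambda>h. ereal ((V (S (s + h) x) - V (S s x)) / h))
      \<le> ereal (- (1 / c) * V (S s x))" if "0 \<le> s" for s
  proof -
    have "eventually (\<lambda>h. ereal ((V (S (s + h) x) - V (S s x)) / h)
        = ereal ((V (S h (S s x)) - V (S s x)) / h)) (at_right 0)"
      using eventually_at_right_less[of "0 :: real"]
    proof eventually_elim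
      case (elim h)
      have "S (s + h) = S h o\<^sub>L S s"
        using S_add[of h s] elim that by (simp add: add.commute)
      thus ?case by simp
    qed
    hence "Liminf (at_right 0) (\<lambda>h. ereal ((V (S (s + h) x) - V (S s x)) / h))
        = lower_right_Dini S V (S s x)"
      unfolding lower_right_Dini_def by (rule Liminf_eq)
    also have "\<dots> \<le> ereal (- (norm (S s x) powr p))"
      using V by (simp add: lyapunov_functional_def)
    also have "\<dots> \<le> ereal (- (1 / c) * V (S s x))"
      using lyapunov_upper[of "S s x"] c by (simp add: field_simps)
    finally show ?thesis .
  qed
  have "0 < norm x powr p" using False by simp
  also have "\<dots> \<le> V x" by (rule lyapunov_coercive)
  finally have "0 < V (S 0 x)" by simp
  hence "V (S t x) \<le> V (S 0 x) * exp (- (1 / (2 * c)) * t)"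
    using c assms Dini by (intro exponential_decay_of_Dini[OF cont, where a = "1 / c"]) (auto simp: field_simps)
  thus ?thesis by simp
qed

lemma lyapunov_jump_decay:
  assumes "1 - 1 / c \<le> q"
  shows "V (J x) \<le> q * V x"
proof -
  have "V x / c \<le> norm x powr p"
    using lyapunov_upper[of x] c by (simp add: field_simps)
  moreover have "V (J x) - V x \<le> - (norm x powr p)"
    using V by (simp add: lyapunov_functional_def)
  ultimately have "V (J x) \<le> (1 - 1 / c) * V x" by (simp add: algebra_simps)
  also have "\<dots> \<le> q * V x"
    using assms lyapunov_coercive[of x] by (intro mult_right_mono) (auto intro: order_trans[OF powr_ge_zero])
  finally show ?thesis .
qed

text \<open>The flow and jump factors accumulate along the list of impulse times, and the exponential factors
  combine to that of the whole interval.\<close>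

lemma lyapunov_evolve_decay:
  assumes "1 - 1 / c \<le> q" "0 \<le> q" "s \<le> t" "sorted \<tau>s" "\<forall>\<tau>\<in>set \<tau>s. s \<le> \<tau> \<and> \<tau> \<le> t"
  shows "V (evolve S J t s \<tau>s x) \<le> q ^ length \<tau>s * exp (- (1 / (2 * c)) * (t - s)) * V x"
  using assms(3-5)
proof (induction \<tau>s arbitrary: s x)
  case Nil
  thus ?case using lyapunov_flow_decay[of "t - s" x] by (simp add: mult.commute)
next
  case (Cons \<tau> \<tau>s)
  let ?b = "- (1 / (2 * c))" and ?y = "S (\<tau> - s) x"
  have "V (evolve S J t s (\<tau> # \<tau>s) x) = V (evolve S J t \<tau> \<tau>s (J ?y))" by simp
  also have "\<dots> \<le> q ^ length \<tau>s * exp (?b * (t - \<tau>)) * V (J ?y)"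
    using Cons.prems by (intro Cons.IH) auto
  also have "\<dots> \<le> q ^ length \<tau>s * exp (?b * (t - \<tau>)) * (q * (V x * exp (?b * (\<tau> - s))))"
  proof (intro mult_left_mono)
    have "V (J ?y) \<le> q * V ?y" by (rule lyapunov_jump_decay[OF assms(1)])
    also have "\<dots> \<le> q * (V x * exp (?b * (\<tau> - s)))"
      using Cons.prems by (intro mult_left_mono lyapunov_flow_decay assms(2)) auto
    finally show "V (J ?y) \<le> q * (V x * exp (?b * (\<tau> - s)))" .
  qed (use assms(2) in auto)
  also have "\<dots> = q ^ length (\<tau> # \<tau>s) * (exp (?b * (t - \<tau>)) * exp (?b * (\<tau> - s))) * V x"
    by simp
  also have "exp (?b * (t - \<tau>)) * exp (?b * (\<tau> - s)) = exp (?b * (t - s))"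
    unfolding exp_add[symmetric] distrib_left[symmetric] by simp
  finally show ?case .
qed

lemma strong_UGES_of_lyapunov: "strong_UGES S J F"
proof -
  \<comment> \<open>For \<open>c = 1\<close> (and formally for \<open>c < 1\<close>) the factor \<open>1 - 1/c\<close> is not positive,
    whereas the decay rate per impulse has to lie strictly between \<open>0\<close> and \<open>1\<close>.\<close>
  define q where "q = max (1 - 1 / c) (1 / 2)"
  have q: "1 - 1 / c \<le> q" "0 < q" "q < 1" using c by (auto simp: q_def)
  define M where "M = max 1 (c powr (1 / p))"
  define \<alpha> where "\<alpha> = 1 / (2 * c) / p"
  define \<rho> where "\<rho> = q powr (1 / p)"
  have "norm (propagator S J \<sigma> t s) \<le> M * \<rho> ^ impulse_count \<sigma> t s * exp (- \<alpha> * (t - s))"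
    if "s \<le> t" for \<sigma> t s
  proof (rule norm_blinfun_bound)
    define A where "A = impulse_times \<sigma> \<inter> {s<..t}"
    define n where "n = card A"
    fix x
    let ?U = "propagator S J \<sigma> t s" and ?e = "exp (- (1 / (2 * c)) * (t - s))"
    have sub: "set (sorted_list_of_set A) \<subseteq> A"
      by (cases "finite A") auto
    have "norm (?U x) powr p \<le> V (?U x)" by (rule lyapunov_coercive)
    also have "\<dots> \<le> q ^ length (sorted_list_of_set A) * ?e * V x"
      unfolding propagator_def A_def[symmetric]
      using q that sub by (intro lyapunov_evolve_decay) (auto simp: A_def)
    also have "\<dots> = q ^ n * ?e * V x" by (simp add: n_def)
    also have "\<dots> \<le> q ^ n * ?e * (c * norm x powr p)"
      using q by (intro mult_left_mono lyapunov_upper) auto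
    finally have "(norm (?U x) powr p) powr (1 / p) \<le> (q ^ n * ?e * (c * norm x powr p)) powr (1 / p)"
      using p by (intro powr_mono2) auto
    also have "\<dots> = \<rho> ^ n * exp (- \<alpha> * (t - s)) * (c powr (1 / p) * norm x)"
    proof -
      have "(q ^ n) powr (1 / p) = \<rho> ^ n"
        using q by (simp add: \<rho>_def powr_powr mult.commute flip: powr_realpow)
      moreover have "?e powr (1 / p) = exp (- \<alpha> * (t - s))"
        by (simp add: exp_powr_real \<alpha>_def)
      moreover have "(norm x powr p) powr (1 / p) = norm x"
        using p by (simp add: powr_powr)
      ultimately show ?thesis using q c by (simp add: powr_mult)
    qed
    also have "\<dots> \<le> \<rho> ^ n * exp (- \<alpha> * (t - s)) * (M * norm x)"
      by (intro mult_left_mono mult_right_mono) (auto simp: M_def \<rho>_def)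
    finally show "norm (?U x) \<le> M * \<rho> ^ impulse_count \<sigma> t s * exp (- \<alpha> * (t - s)) * norm x"
      using p by (simp add: powr_powr impulse_count_def n_def A_def mult_ac)
  qed (auto simp: M_def \<rho>_def)
  moreover have "1 \<le> M" "0 < \<alpha>" "0 < \<rho>" "\<rho> < 1"
    using c p q powr_less_mono2[of "1 / p" q 1] by (auto simp: M_def \<alpha>_def \<rho>_def)
  ultimately show ?thesis unfolding strong_UGES_def by blast
qed

end

end

section \<open>The equivalence\<close>

text \<open>An impulse sequence whose first impulse comes after time \<open>t\<close> has \<open>S t\<close> as its propagator over
  \<open>[0, t]\<close>.\<close>

lemma growth_condition_semigroup_bound:
  assumes "growth_condition S J impulse_seqs"
  shows "\<exists>G>0. \<forall>t\<ge>0. norm (S t) \<le> G"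
proof -
  obtain g \<mu> where "bdd_above (g ` {0..})"
    and growth: "\<And>\<sigma> t s x. \<sigma> \<in> impulse_seqs \<Longrightarrow> 0 \<le> s \<Longrightarrow> s \<le> t \<Longrightarrow>
      norm (propagator S J \<sigma> t s x) \<le> g (t - s) * \<mu> ^ impulse_count \<sigma> t s * norm x"
    using assms unfolding growth_condition_def by metis
  then obtain B where B: "\<And>t. 0 \<le> t \<Longrightarrow> g t \<le> B" unfolding bdd_above_def by (metis atLeast_iff imageI)
  have "norm (S t) \<le> max B 1" if "0 \<le> t" for t
  proof (rule norm_blinfun_bound)
    fix x
    define \<sigma> where "\<sigma> = (\<lambda>k. real k * (t + 1))"
    have "filterlim \<sigma> at_top sequentially"
      unfolding \<sigma>_def using that
      by (intro filterlim_at_top_mult_tendsto_pos[OF tendsto_const _ filterlim_real_sequentially]) auto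
    hence \<sigma>: "\<sigma> \<in> impulse_seqs" using that by (auto simp: impulse_seqs_def \<sigma>_def)
    have "impulse_times \<sigma> \<inter> {0<..t} = {}"
      using impulse_times_upto[OF \<sigma>, of 0 t] that by (simp add: \<sigma>_def)
    hence "norm (S t x) \<le> g t * norm x"
      using growth[OF \<sigma>, of 0 t x] that by (simp add: propagator_def impulse_count_def)
    also have "\<dots> \<le> max B 1 * norm x"
      using B[OF that] by (intro mult_right_mono) auto
    finally show "norm (S t x) \<le> max B 1 * norm x" .
  qed simp
  thus ?thesis by (intro exI[of _ "max B 1"]) auto
qed

theorem theorem4p5:
  fixes S :: "real \<Rightarrow> 'a::banach \<Rightarrow>\<^sub>L 'a" and J :: "'a \<Rightarrow>\<^sub>L 'a"
    and DA :: "'a set" and A :: "'a \<Rightarrow> 'a"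
  assumes "generates DA A S"
    and "J \<noteq> 0"
    and "blinfun_apply J ` DA \<subseteq> DA"
    and "growth_condition S J impulse_seqs"
  shows "(strong_UGES S J impulse_seqs \<longleftrightarrow>
           (\<exists>c p V. c > 0 \<and> p \<ge> 1 \<and> lyapunov_functional S J c p V)) \<and>
         (strong_UGES S J impulse_seqs \<longrightarrow>
           (\<forall>p\<ge>1. (\<forall>x. explicit_V S J p x < \<infinity>) \<and>
              (\<exists>c>0. lyapunov_functional S J c p (\<lambda>x. enn2real (explicit_V S J p x)))))"
proof -
  obtain G where "0 < G" "\<forall>t\<ge>0. norm (S t) \<le> G"
    using growth_condition_semigroup_bound[OF assms(4)] by blast
  then interpret impulsive_system S J G
    using assms(1) by unfold_locales (auto simp: generates_def)
  show ?thesis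
    using explicit_V_lyapunov strong_UGES_of_lyapunov by (meson order_refl)
qed

end
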